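(* If $n = 12m$ with $m \geq 1$ an integer, then the circulant graph $C(n,\{1,2,3\})$ is nearly dispersable.
   Context: All graphs are finite and simple. For a set $S=\{i_1<\cdots<i_k\}$ of integers with $k\ge 1$, $1\le i_1$ and $i_k\le \lfloor n/2\rfloor$, the circulant $C(n,S)$ is the graph on vertex set $\{1,\ldots,n\}$ in which each $j$ is adjacent to $j+i_r$ (addition mod $n$) for $r=1,\ldots,k$. Given a graph $G$ and a cyclic order $\omega$ on $V(G)$, draw the vertices on a circle in the order $\omega$ and the edges as straight chords; two edges cross if they intersect at a point that is not an endpoint. A matching book embedding $(G,\omega,c)$ consists of $G$, a cyclic order $\omega$, and an edge-coloring $c$ (the color classes are the pages) such that any two distinct edges of the same color neither cross nor share an endpoint. The embedding is dispersable if the number of colors equals the maximum degree $\Delta(G)$, and nearly dispersable if the number of colors equals $1+\Delta(G)$. A graph is dispersable if it has a dispersable matching book embedding; it is nearly dispersable if it is not dispersable and has a nearly dispersable matching book embedding. *)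

theory Defs
  imports "HOL-Analysis.Analysis" "HOL-Number_Theory.Cong"
begin

type_synonym 'a graph = "'a set \<times> 'a set set"

abbreviation verts :: "'a graph \<Rightarrow> 'a set" where
  "verts G \<equiv> fst G"

abbreviation edges :: "'a graph \<Rightarrow> 'a set set" where
  "edges G \<equiv> snd G"

definition simple_graph :: "'a graph \<Rightarrow> bool" where
  "simple_graph G \<longleftrightarrow>
     finite (verts G) \<and> (\<forall>e\<in>edges G. e \<subseteq> verts G \<and> card e = 2)"

definition degree :: "'a graph \<Rightarrow> 'a \<Rightarrow> nat" where
  "degree G v = card {e \<in> edges G. v \<in> e}"

text \<open>Meaningful for finite graphs with at least one vertex.\<close>

definition max_degree :: "'a graph \<Rightarrow> nat" where
  "max_degree G = (MAX v\<in>verts G. degree G v)"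

text \<open>Intended for nonempty \<open>S \<subseteq> {1..n div 2}\<close>. The representatives of the residues mod \<open>n\<close>
  are \<open>1, \<dots>, n\<close>, so the end of an edge is picked by a congruence rather than by \<open>mod\<close>.\<close>

definition circulant :: "nat \<Rightarrow> nat set \<Rightarrow> nat graph" where
  "circulant n S =
     ({1..n}, {{j, k} | j k i. j \<in> {1..n} \<and> k \<in> {1..n} \<and> i \<in> S \<and> [k = j + i] (mod n)})"

text \<open>A cyclic order is given by numbering the vertices \<open>0, \<dots>, |V| - 1\<close> in the order in which they
  are met on the circle. Every cyclic order arises this way; numberings that differ by a rotation
  represent the same one.\<close>

definition cyclic_order :: "'a set \<Rightarrow> ('a \<Rightarrow> nat) \<Rightarrow> bool" where
  "cyclic_order V \<omega> \<longleftrightarrow> bij_betw \<omega> V {..<card V}"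

text \<open>The vertices are drawn equally spaced on the unit circle of the complex plane.\<close>

definition circle_point :: "'a set \<Rightarrow> ('a \<Rightarrow> nat) \<Rightarrow> 'a \<Rightarrow> complex" where
  "circle_point V \<omega> v = cis (2 * pi * real (\<omega> v) / real (card V))"

text \<open>For an edge \<open>e = {u, v}\<close> the convex hull is the closed segment between the points of
  \<open>u\<close> and \<open>v\<close>.\<close>

definition chord :: "'a set \<Rightarrow> ('a \<Rightarrow> nat) \<Rightarrow> 'a set \<Rightarrow> complex set" where
  "chord V \<omega> e = convex hull (circle_point V \<omega> ` e)"

definition cross :: "'a set \<Rightarrow> ('a \<Rightarrow> nat) \<Rightarrow> 'a set \<Rightarrow> 'a set \<Rightarrow> bool" where
  "cross V \<omega> e f \<longleftrightarrow>
     (\<exists>z \<in> chord V \<omega> e \<inter> chord V \<omega> f. z \<notin> circle_point V \<omega> ` (e \<union> f))"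

definition matching_book_embedding ::
    "'a graph \<Rightarrow> ('a \<Rightarrow> nat) \<Rightarrow> ('a set \<Rightarrow> nat) \<Rightarrow> bool" where
  "matching_book_embedding G \<omega> c \<longleftrightarrow>
     simple_graph G \<and> cyclic_order (verts G) \<omega> \<and>
     (\<forall>e\<in>edges G. \<forall>f\<in>edges G. e \<noteq> f \<and> c e = c f \<longrightarrow>
        \<not> cross (verts G) \<omega> e f \<and> e \<inter> f = {})"

definition num_colors :: "'a graph \<Rightarrow> ('a set \<Rightarrow> nat) \<Rightarrow> nat" where
  "num_colors G c = card (c ` edges G)"

definition dispersable :: "'a graph \<Rightarrow> bool" where
  "dispersable G \<longleftrightarrow>
     (\<exists>\<omega> c. matching_book_embedding G \<omega> c \<and> num_colors G c = max_degree G)"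

definition nearly_dispersable :: "'a graph \<Rightarrow> bool" where
  "nearly_dispersable G \<longleftrightarrow> \<not> dispersable G \<and>
     (\<exists>\<omega> c. matching_book_embedding G \<omega> c \<and> num_colors G c = 1 + max_degree G)"

end

theory Submission imports Defs begin

text \<open>The graph is 6-regular, so six pages must be excluded and seven exhibited. With six
  pages every page would be a perfect matching. An edge of a page then separates the other vertices
  into two arcs, each matched within itself, so its ends lie at positions of opposite parity
  (\<open>dispersable_regular_parity\<close>). The graph would be bipartite, but 1, 2, 3 form a
  triangle (\<open>circulant_123_not_dispersable\<close>).

  For seven pages keep the natural order. Cut the circle into consecutive triples, each carrying one
  edge of length 2: the three possible cuts give three pages. Cut it into consecutive quadruples,
  each carrying an edge of length 3 with an edge of length 1 nested under it: the four cuts give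
  four pages. The cuts close up around the circle because 12 divides \<open>n\<close>; hence edges
  on one page are disjoint or nested (\<open>page_conflict_free\<close>). Both halves rest on
  translating geometric crossing into interleaving of positions
  (\<open>cross_if_interleaved\<close>, \<open>not_cross_if_not_interleaved\<close>).\<close>

section \<open>Crossing chords and interleaved positions\<close>

text \<open>Signed distance of \<open>z\<close> from the line through the points numbered
  \<open>p\<close> and \<open>q\<close> among \<open>N\<close> equally spaced ones. Rotating by
  minus the mean angle makes the line vertical; for \<open>p < q < N\<close> the positive side is
  that of the arc from \<open>p\<close> to \<open>q\<close>.\<close>

definition side :: "nat \<Rightarrow> nat \<Rightarrow> nat \<Rightarrow> complex \<Rightarrow> real" where
  "side N p q z =
     Re (z * cis (- (pi * (real p + real q) / real N))) - cos (pi * (real q - real p) / real N)"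

lemma side_affine:
  "side N p q ((1 - t) *\<^sub>R x + t *\<^sub>R y) = (1 - t) * side N p q x + t * side N p q y"
  by (simp add: side_def algebra_simps)

text \<open>The product form makes the sign on the circle readable: for indices below
  \<open>N\<close> each sine has the sign of its index difference.\<close>

lemma side_cis:
  "side N p q (cis (2 * pi * real r / real N)) =
     2 * sin (pi * (real r - real p) / real N) * sin (pi * (real q - real r) / real N)"
proof -
  have "side N p q (cis (2 * pi * real r / real N)) =
      cos (2 * pi * real r / real N - pi * (real p + real q) / real N)
        - cos (pi * (real q - real p) / real N)"
    by (simp add: side_def cis_mult)
  also have "\<dots> = 2 * sin (pi * (real r - real p) / real N) * sin (pi * (real q - real r) / real N)"
    unfolding cos_diff_cos
    by (intro arg_cong2[of _ _ _ _ "(*)"] arg_cong[of _ _ sin] refl)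
       (simp_all add: diff_divide_distrib add_divide_distrib algebra_simps)
  finally show ?thesis .
qed

lemma sin_pi_frac_pos:
  assumes "p < r" "r < N"
  shows "sin (pi * (real r - real p) / real N) > 0"
proof (rule sin_gt_zero)
  show "0 < pi * (real r - real p) / real N"
    using assms by simp
  have "real r - real p < real N"
    using assms by linarith
  then show "pi * (real r - real p) / real N < pi"
    using assms by (simp add: divide_simps)
qed

lemma sin_pi_frac_neg:
  assumes "r < p" "p < N"
  shows "sin (pi * (real r - real p) / real N) < 0"
proof -
  have "pi * (real r - real p) / real N = - (pi * (real p - real r) / real N)"
    by (simp add: diff_divide_distrib algebra_simps)
  then show ?thesis
    using sin_pi_frac_pos[OF assms] by simp
qed

lemma side_pos:
  assumes "p < r" "r < q" "q < N"
  shows "side N p q (cis (2 * pi * real r / real N)) > 0"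
  unfolding side_cis using assms by (simp add: sin_pi_frac_pos)

lemma side_neg:
  assumes "p < q" "q < N" "r < N" "r < p \<or> q < r"
  shows "side N p q (cis (2 * pi * real r / real N)) < 0"
  unfolding side_cis using assms sin_pi_frac_pos sin_pi_frac_neg
  by (auto simp: mult_less_0_iff)

lemma side_ends:
  "side N p q (cis (2 * pi * real p / real N)) = 0" "side N p q (cis (2 * pi * real q / real N)) = 0"
  by (simp_all add: side_cis)

lemma side_zero_on_segment:
  assumes "z \<in> closed_segment (cis (2 * pi * real p / real N)) (cis (2 * pi * real q / real N))"
  shows "side N p q z = 0"
  using assms by (auto simp: closed_segment_def side_affine side_ends)

text \<open>Rotated by half the sum of the two angles, the chord becomes vertical; a point of its line that
  lies in the unit disc then has imaginary part at most that of the endpoints.\<close>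

lemma disc_side_zero_in_segment:
  assumes "p < q" "q < N" "norm z \<le> 1" "side N p q z = 0"
  shows "z \<in> closed_segment (cis (2 * pi * real p / real N)) (cis (2 * pi * real q / real N))"
proof -
  define h where "h = pi * (real q - real p) / real N"
  define \<mu> where "\<mu> = pi * (real p + real q) / real N"
  define w where "w = z * cis (- \<mu>)"
  \<comment> \<open>Along the chord \<open>Im w\<close> runs from \<open>- sin h\<close> to
    \<open>sin h\<close>; \<open>t\<close> rescales this range to the unit interval.\<close>
  define t where "t = (Im w / sin h + 1) / 2"
  have s: "sin h > 0"
    unfolding h_def using assms by (intro sin_pi_frac_pos)
  have re: "Re w = cos h"
    using assms by (simp add: side_def w_def \<mu>_def h_def)
  have "norm w \<le> 1"
    using assms by (simp add: w_def norm_mult)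
  then have "(Re w)\<^sup>2 + (Im w)\<^sup>2 \<le> 1"
    by (simp add: norm_complex_def)
  then have "(Im w)\<^sup>2 \<le> (sin h)\<^sup>2"
    using sin_cos_squared_add[of h] unfolding re by linarith
  then have "\<bar>Im w\<bar> \<le> sin h"
    using s by (simp add: abs_le_square_iff[symmetric])
  then have t: "0 \<le> t" "t \<le> 1"
    using s by (auto simp: t_def divide_simps abs_le_iff)
  have w_eq: "w = (1 - t) *\<^sub>R cis (- h) + t *\<^sub>R cis h"
    using s re by (simp add: complex_eq_iff t_def field_simps)
  have "w * cis \<mu> = (1 - t) *\<^sub>R (cis (- h) * cis \<mu>) + t *\<^sub>R (cis h * cis \<mu>)"
    by (simp only: w_eq distrib_right mult_scaleR_left)
  moreover have "w * cis \<mu> = z"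
    by (simp add: w_def mult.assoc cis_mult)
  moreover have "- h + \<mu> = 2 * pi * real p / real N" "h + \<mu> = 2 * pi * real q / real N"
    by (simp_all add: h_def \<mu>_def diff_divide_distrib add_divide_distrib algebra_simps)
  ultimately have "z = (1 - t) *\<^sub>R cis (2 * pi * real p / real N) + t *\<^sub>R cis (2 * pi * real q / real N)"
    by (simp add: cis_mult)
  then show ?thesis
    using t by (auto simp: closed_segment_def)
qed

lemma chord_eq:
  "chord V \<omega> {u, v} =
     closed_segment (cis (2 * pi * real (\<omega> u) / real (card V))) (cis (2 * pi * real (\<omega> v) / real (card V)))"
  by (simp add: chord_def circle_point_def segment_convex_hull)

lemma cross_commute: "cross V \<omega> e f \<longleftrightarrow> cross V \<omega> f e"
  by (auto simp: cross_def Un_commute)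

text \<open>The ends of one chord lie strictly on opposite sides of the line of the other, so that
  line is met inside the first chord. The meeting point is in the disc, hence on the second chord as
  well.\<close>

lemma cross_if_interleaved:
  assumes "\<omega> u < \<omega> x" "\<omega> x < \<omega> v" "\<omega> v < \<omega> y" "\<omega> y < card V"
  shows "cross V \<omega> {u, v} {x, y}"
proof -
  define P where "P a = cis (2 * pi * real (\<omega> a) / real (card V))" for a
  define F where "F = side (card V) (\<omega> u) (\<omega> v)"
  define H where "H = side (card V) (\<omega> x) (\<omega> y)"
  \<comment> \<open>Linear interpolation: the parameter at which \<open>F\<close> vanishes on the
    chord from \<open>P x\<close> to \<open>P y\<close>.\<close>
  define t where "t = F (P x) / (F (P x) - F (P y))"
  define z where "z = (1 - t) *\<^sub>R P x + t *\<^sub>R P y"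
  have Fx: "F (P x) > 0" and Fy: "F (P y) < 0"
    unfolding F_def P_def using assms by (simp_all add: side_pos side_neg)
  have Hu: "H (P u) < 0" and Hv: "H (P v) > 0"
    unfolding H_def P_def using assms by (simp_all add: side_pos side_neg)
  have t: "0 \<le> t" "t \<le> 1"
    using Fx Fy by (simp_all add: t_def divide_simps)
  have z: "z \<in> closed_segment (P x) (P y)"
    using t by (auto simp: z_def closed_segment_def)
  have Hz: "H z = 0"
    using z unfolding H_def P_def by (rule side_zero_on_segment)
  have "F z = (1 - t) * F (P x) + t * F (P y)"
    by (simp add: z_def F_def side_affine)
  then have Fz: "F z = 0"
    using Fx Fy by (simp add: t_def field_simps)
  have "closed_segment (P x) (P y) \<subseteq> cball 0 1"
    by (intro closed_segment_subset) (simp_all add: P_def)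
  then have "norm z \<le> 1"
    using z by auto
  then have "z \<in> closed_segment (P u) (P v)"
    using assms Fz unfolding P_def F_def by (intro disc_side_zero_in_segment) auto
  then have "z \<in> chord V \<omega> {u, v} \<inter> chord V \<omega> {x, y}"
    using z by (simp add: chord_eq P_def)
  \<comment> \<open>Both \<open>F\<close> and \<open>H\<close> vanish at \<open>z\<close>, while
    each of the four ends has a nonzero value of one of them.\<close>
  moreover have "z \<notin> circle_point V \<omega> ` ({u, v} \<union> {x, y})"
  proof
    assume "z \<in> circle_point V \<omega> ` ({u, v} \<union> {x, y})"
    then have "z \<in> {P u, P v, P x, P y}"
      by (auto simp: circle_point_def P_def)
    then show False
      using Fx Fy Fz Hu Hv Hz by auto
  qed
  ultimately show ?thesis
    unfolding cross_def by blast
qed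

text \<open>\<open>F\<close> has one strict sign at both ends of the second chord, hence on all of
  it, but is zero on the first chord.\<close>

lemma not_cross_if_not_interleaved:
  assumes "\<omega> u < \<omega> v" "\<omega> v < card V" "\<omega> x < card V" "\<omega> y < card V"
    and "{\<omega> x, \<omega> y} \<subseteq> {\<omega> u<..<\<omega> v} \<or> {\<omega> x, \<omega> y} \<inter> {\<omega> u..\<omega> v} = {}"
  shows "\<not> cross V \<omega> {u, v} {x, y}"
proof
  define P where "P a = cis (2 * pi * real (\<omega> a) / real (card V))" for a
  define F where "F = side (card V) (\<omega> u) (\<omega> v)"
  assume "cross V \<omega> {u, v} {x, y}"
  then obtain z where z: "z \<in> closed_segment (P u) (P v)" "z \<in> closed_segment (P x) (P y)"
    by (auto simp: cross_def chord_eq P_def)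
  have Fz: "F z = 0"
    using z(1) unfolding F_def P_def by (rule side_zero_on_segment)
  obtain t where t: "0 \<le> t" "t \<le> 1" "z = (1 - t) *\<^sub>R P x + t *\<^sub>R P y"
    using z(2) by (auto simp: closed_segment_def)
  have zero: "(1 - t) * F (P x) + t * F (P y) = 0"
    using Fz t(3) by (simp add: F_def side_affine)
  consider "F (P x) > 0" "F (P y) > 0" | "F (P x) < 0" "F (P y) < 0"
  proof -
    have "F (P x) > 0 \<and> F (P y) > 0 \<or> F (P x) < 0 \<and> F (P y) < 0"
      using assms side_pos side_neg unfolding F_def P_def by (auto simp: not_le)
    then show ?thesis
      using that by blast
  qed
  then show False
  proof cases
    case 1
    then have "0 < (1 - t) * F (P x) + t * F (P y)"
      using t convex_bound_lt[of "- F (P x)" 0 "- F (P y)" "1 - t" t] by simp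
    then show False
      using zero by simp
  next
    case 2
    then have "(1 - t) * F (P x) + t * F (P y) < 0"
      using t convex_bound_lt[of "F (P x)" 0 "F (P y)" "1 - t" t] by simp
    then show False
      using zero by simp
  qed
qed

section \<open>Regular dispersable graphs are bipartite\<close>

text \<open>If a regular graph has as many pages as its degree, every page is a perfect matching. The vertices
  strictly between the ends of an edge are then matched among themselves by the page of that edge,
  so their number is even.\<close>

lemma dispersable_regular_parity:
  assumes mbe: "matching_book_embedding G \<omega> c"
    and reg: "\<And>v. v \<in> verts G \<Longrightarrow> degree G v = num_colors G c"
    and e: "{u, v} \<in> edges G" and less: "\<omega> u < \<omega> v"
  shows "even (\<omega> u) \<longleftrightarrow> odd (\<omega> v)"
proof -
  define V where "V = verts G"
  define B where "B = {w \<in> V. \<omega> u < \<omega> w \<and> \<omega> w < \<omega> v}"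
  define M where "M = {f \<in> edges G. c f = c {u, v} \<and> f \<inter> B \<noteq> {}}"
  have simple: "finite V" "\<And>f. f \<in> edges G \<Longrightarrow> f \<subseteq> V \<and> card f = 2"
    and bij: "bij_betw \<omega> V {..<card V}"
    and page: "\<And>f g. f \<in> edges G \<Longrightarrow> g \<in> edges G \<Longrightarrow> f \<noteq> g \<Longrightarrow> c f = c g \<Longrightarrow>
       \<not> cross V \<omega> f g \<and> f \<inter> g = {}"
    using mbe by (auto simp: matching_book_embedding_def simple_graph_def cyclic_order_def V_def)
  have "edges G \<subseteq> Pow V"
    using simple(2) by blast
  then have finE: "finite (edges G)"
    using simple(1) by (meson finite_Pow_iff finite_subset)
  have inj: "inj_on \<omega> V" and lt: "\<And>w. w \<in> V \<Longrightarrow> \<omega> w < card V"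
    using bij by (auto simp: bij_betw_def)
  have uv: "u \<in> V" "v \<in> V"
    using simple(2)[OF e] by auto
  \<comment> \<open>Edges at \<open>w\<close> share \<open>w\<close> and so have distinct colours;
    there are as many of them as colours, so every colour occurs.\<close>
  have saturated: "\<exists>f\<in>edges G. w \<in> f \<and> c f = c {u, v}" if "w \<in> V" for w
  proof -
    let ?S = "{f \<in> edges G. w \<in> f}"
    have "inj_on c ?S"
      using page by (fastforce simp: inj_on_def)
    then have "card (c ` ?S) = card (c ` edges G)"
      using reg that by (simp add: card_image degree_def num_colors_def V_def)
    then have "c ` ?S = c ` edges G"
      using finE by (intro card_subset_eq) auto
    then have "c {u, v} \<in> c ` ?S"
      using e by blast
    then show ?thesis
      by force
  qed
  \<comment> \<open>An edge of this page leaving \<open>B\<close> would end at \<open>u\<close> or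
    \<open>v\<close>, or cross the chord \<open>{u, v}\<close>.\<close>
  have inside: "f \<subseteq> B" if f: "f \<in> M" for f
  proof -
    obtain w where w: "w \<in> f" "w \<in> B"
      using f by (auto simp: M_def)
    have fE: "f \<in> edges G" "c f = c {u, v}"
      using f by (auto simp: M_def)
    obtain x where x: "f = {w, x}"
      using simple(2)[OF fE(1)] w(1) by (metis card_2_iff doubleton_eq_iff insertE singletonD)
    have xV: "x \<in> V"
      using simple(2)[OF fE(1)] x by auto
    have "f \<noteq> {u, v}"
      using w by (auto simp: B_def)
    from page[OF fE(1) e this fE(2)]
    have nc: "\<not> cross V \<omega> {w, x} {u, v}" "x \<noteq> u" "x \<noteq> v"
      by (auto simp: x)
    have wlt: "\<omega> u < \<omega> w" "\<omega> w < \<omega> v"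
      using w by (auto simp: B_def)
    have "\<omega> x \<noteq> \<omega> u" "\<omega> x \<noteq> \<omega> v"
      using nc xV uv inj by (auto dest: inj_onD)
    moreover have "\<not> \<omega> v < \<omega> x"
      using cross_if_interleaved[of \<omega> u w v x V] wlt lt[OF xV] nc(1) by (auto simp: cross_commute)
    moreover have "\<not> \<omega> x < \<omega> u"
      using cross_if_interleaved[of \<omega> x u w v V] wlt lt[OF uv(2)] nc(1) by (auto simp: insert_commute)
    ultimately show ?thesis
      using w xV by (auto simp: x B_def)
  qed
  have UM: "\<Union>M = B"
  proof
    show "\<Union>M \<subseteq> B"
      using inside by blast
    show "B \<subseteq> \<Union>M"
      using saturated by (fastforce simp: M_def B_def)
  qed
  have "finite B"
    using simple(1) by (simp add: B_def)
  then have "2 * card M = card (\<Union>M)"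
    using finE simple(2) page by (intro card_partition) (auto simp: M_def UM[unfolded M_def])
  then have "even (card B)"
    by (metis UM dvd_triv_left)
  moreover have "\<omega> ` B = {\<omega> u<..<\<omega> v}"
  proof -
    have "\<omega> ` V = {..<card V}"
      using bij by (simp add: bij_betw_def)
    have "k \<in> \<omega> ` B" if k: "\<omega> u < k" "k < \<omega> v" for k
    proof -
      have "k \<in> \<omega> ` V"
        unfolding \<open>\<omega> ` V = {..<card V}\<close> using k lt[OF uv(2)] by simp
      then show ?thesis
        using k by (auto simp: B_def)
    qed
    then show ?thesis
      by (auto simp: B_def)
  qed
  moreover have "inj_on \<omega> B"
    using inj by (rule inj_on_subset) (auto simp: B_def)
  ultimately have "even (\<omega> v - Suc (\<omega> u))"
    by (metis card_greaterThanLessThan card_image)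
  then show ?thesis
    using less by auto
qed

text \<open>By symmetry the order of the two ends does not matter: parity of position is a proper
  2-colouring, which any odd cycle refutes.\<close>

lemma dispersable_regular_bipartite:
  assumes "matching_book_embedding G \<omega> c"
    and "\<And>v. v \<in> verts G \<Longrightarrow> degree G v = num_colors G c"
    and "{u, v} \<in> edges G"
  shows "even (\<omega> u) \<longleftrightarrow> odd (\<omega> v)"
proof -
  have "inj_on \<omega> (verts G)" "{u, v} \<subseteq> verts G" "card {u, v} = 2"
    using assms(1,3)
    by (auto simp: matching_book_embedding_def simple_graph_def cyclic_order_def bij_betw_def)
  moreover from this have "u \<noteq> v"
    by auto
  ultimately have "\<omega> u \<noteq> \<omega> v"
    by (simp add: inj_on_eq_iff)
  then consider "\<omega> u < \<omega> v" | "\<omega> v < \<omega> u"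
    by linarith
  then show ?thesis
  proof cases
    case 1
    with assms show ?thesis
      by (rule dispersable_regular_parity)
  next
    case 2
    have "{v, u} \<in> edges G"
      using assms(3) by (simp add: insert_commute)
    from dispersable_regular_parity[OF assms(1,2) this 2] show ?thesis
      by blast
  qed
qed

section \<open>Edges and degrees of the circulant; no six pages\<close>

lemma verts_circulant [simp]: "verts (circulant n S) = {1..n}"
  by (simp add: circulant_def)

lemma circulant_doubleton_iff:
  assumes "a \<in> {1..n}" "b \<in> {1..n}"
  shows "{a, b} \<in> edges (circulant n S) \<longleftrightarrow> (\<exists>i\<in>S. [b = a + i] (mod n) \<or> [a = b + i] (mod n))"
  using assms by (auto simp: circulant_def doubleton_eq_iff)

text \<open>Steps are smaller than \<open>n\<close>, so the congruence either holds as an equation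
  or wraps around exactly once.\<close>

lemma circulant_edge_iff:
  assumes "a \<in> {1..n}" "b \<in> {1..n}" "a < b" "S \<subseteq> {1..<n}"
  shows "{a, b} \<in> edges (circulant n S) \<longleftrightarrow> b - a \<in> S \<or> n - (b - a) \<in> S"
proof -
  have fwd: "[b = a + i] (mod n) \<longleftrightarrow> i = b - a" if "i \<in> S" for i
  proof
    assume "[b = a + i] (mod n)"
    then have "[a + (b - a) = a + i] (mod n)"
      using assms by simp
    then have "[b - a = i] (mod n)"
      by (simp only: cong_add_lcancel_nat)
    moreover have "b - a < n" "i < n"
      using assms that by auto
    ultimately show "i = b - a"
      by (simp add: cong_def)
  qed (use assms in simp)
  have bwd: "[a = b + i] (mod n) \<longleftrightarrow> i = n - (b - a)" if "i \<in> S" for i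
  proof
    assume "[a = b + i] (mod n)"
    then have "[a + 0 = a + (b - a + i)] (mod n)"
      using assms by simp
    then have "n dvd b - a + i"
      by (metis cong_0_iff cong_add_lcancel_nat cong_sym)
    then obtain k where k: "b - a + i = n * k" ..
    have "b - a < n" "i < n" "0 < b - a"
      using assms that by auto
    \<comment> \<open>A multiple of \<open>n\<close> strictly between 0 and \<open>2 * n\<close> is
      \<open>n\<close> itself.\<close>
    then have "b - a + i < n * 2" "0 < b - a + i"
      by linarith+
    then have "k < 2" "k \<noteq> 0"
      unfolding k by auto
    then have "k = 1" by simp
    then show "i = n - (b - a)"
      using k by simp
  next
    assume "i = n - (b - a)"
    then have "b + i = a + n"
      using assms by auto
    then show "[a = b + i] (mod n)"
      by (simp add: cong_def)
  qed
  then show ?thesis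
    using fwd assms(1,2) by (auto simp: circulant_doubleton_iff)
qed

lemma circulant_edgeE:
  assumes "e \<in> edges (circulant n S)" "S \<subseteq> {1..<n}"
  obtains a b where "e = {a, b}" "1 \<le> a" "a < b" "b \<le> n" "b - a \<in> S \<or> n - (b - a) \<in> S"
proof -
  obtain j k i where e: "e = {j, k}" "j \<in> {1..n}" "k \<in> {1..n}" "i \<in> S" "[k = j + i] (mod n)"
    using assms(1) by (auto simp: circulant_def)
  have "j \<noteq> k"
  proof
    assume "j = k"
    then have "[j + 0 = j + i] (mod n)"
      using e(5) by simp
    then have "n dvd i"
      by (metis cong_0_iff cong_add_lcancel_nat cong_sym)
    then show False
      using e(4) assms(2) by (force dest: dvd_imp_le)
  qed
  then consider "j < k" | "k < j"
    by linarith
  then show thesis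
  proof cases
    case 1
    then show thesis
      using that[of j k] circulant_edge_iff[of j n k S] e assms by auto
  next
    case 2
    then show thesis
      using that[of k j] circulant_edge_iff[of k n j S] e assms by (auto simp: insert_commute)
  qed
qed

lemma simple_graph_circulant:
  assumes "S \<subseteq> {1..<n}"
  shows "simple_graph (circulant n S)"
  unfolding simple_graph_def
proof (intro conjI ballI)
  fix e
  assume "e \<in> edges (circulant n S)"
  then obtain a b where "e = {a, b}" "1 \<le> a" "a < b" "b \<le> n"
    using assms by (rule circulant_edgeE)
  then show "e \<subseteq> verts (circulant n S)" "card e = 2"
    by auto
qed simp

text \<open>The neighbours are \<open>v\<close> shifted by the six offsets of absolute value 1 to 3.
  Two offsets differ by at most 6, so \<open>n\<close> at least 7 keeps the neighbours
  distinct.\<close>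

lemma degree_circulant_123:
  assumes "7 \<le> n" "v \<in> {1..n}"
  shows "degree (circulant n {1, 2, 3}) v = 6"
proof -
  let ?E = "edges (circulant n {1, 2, 3})"
  let ?N = "{w \<in> {1..n}. {v, w} \<in> ?E}"
  \<comment> \<open>The representative of \<open>v + d\<close> in \<open>{1..n}\<close>; subtracting
    1 before the reduction and adding it afterwards avoids the residue 0.\<close>
  define r where "r d = nat ((int v - 1 + d) mod int n) + 1" for d :: int
  have S: "{1, 2, 3} \<subseteq> {1..<n}"
    using assms by auto
  have r_in: "r d \<in> {1..n}" for d
  proof -
    have "0 \<le> (int v - 1 + d) mod int n" "(int v - 1 + d) mod int n < int n"
      using assms by simp_all
    then show ?thesis
      unfolding r_def by simp
  qed
  have r_eq: "w = r d \<longleftrightarrow> [int w = int v + d] (mod int n)" if "w \<in> {1..n}" for w d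
  proof -
    have "w = r d \<longleftrightarrow> int w - 1 = (int v - 1 + d) mod int n"
      using that assms pos_mod_sign[of "int n" "int v - 1 + d"] by (auto simp: r_def)
    also have "\<dots> \<longleftrightarrow> [int w - 1 = int v - 1 + d] (mod int n)"
      using that by (simp add: cong_def)
    also have "\<dots> \<longleftrightarrow> [int w = int v + d] (mod int n)"
      by (simp add: cong_iff_dvd_diff algebra_simps)
    finally show ?thesis .
  qed
  have "{v, w} \<in> ?E \<longleftrightarrow> (\<exists>d\<in>{-3,-2,-1,1,2,3}. w = r d)" if "w \<in> {1..n}" for w
  proof -
    have "{v, w} \<in> ?E \<longleftrightarrow> (\<exists>i\<in>{1, 2, 3}. [w = v + i] (mod n) \<or> [v = w + i] (mod n))"
      using assms(2) that by (rule circulant_doubleton_iff)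
    also have "\<dots> \<longleftrightarrow> (\<exists>i\<in>{1, 2, 3}. [int w = int v + int i] (mod int n) \<or>
        [int w = int v - int i] (mod int n))"
    proof -
      have "[w = v + i] (mod n) \<longleftrightarrow> [int w = int v + int i] (mod int n)" for i
        by (simp flip: cong_int_iff)
      moreover have "[v = w + i] (mod n) \<longleftrightarrow> [int w = int v - int i] (mod int n)" for i
      proof -
        have "[v = w + i] (mod n) \<longleftrightarrow> [int v = int w + int i] (mod int n)"
          by (simp flip: cong_int_iff)
        also have "\<dots> \<longleftrightarrow> [int w = int v - int i] (mod int n)"
          unfolding cong_iff_dvd_diff by (subst dvd_minus_iff[symmetric]) (simp add: algebra_simps)
        finally show ?thesis .
      qed
      ultimately show ?thesis by simp
    qed
    also have "\<dots> \<longleftrightarrow> (\<exists>d\<in>{-3,-2,-1,1,2,3}. [int w = int v + d] (mod int n))"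
      by auto
    finally show ?thesis
      using r_eq[OF that] by simp
  qed
  then have N: "?N = r ` {-3,-2,-1,1,2,3}"
    using r_in by blast
  have "inj_on r {-3,-2,-1,1,2,3}"
  proof (rule inj_onI)
    fix d d' :: int
    assume d: "d \<in> {-3,-2,-1,1,2,3}" "d' \<in> {-3,-2,-1,1,2,3}" and "r d = r d'"
    then have "[int (r d) = int v + d] (mod int n)" "[int (r d) = int v + d'] (mod int n)"
      using r_eq[OF r_in] by auto
    then have "[int v + d = int v + d'] (mod int n)"
      by (meson cong_sym cong_trans)
    then have "int n dvd d - d'"
      by (simp add: cong_iff_dvd_diff)
    moreover have "\<bar>d - d'\<bar> < int n"
      using d assms by auto
    ultimately show "d = d'"
      using dvd_imp_le_int[of "d - d'" "int n"] by auto
  qed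
  then have "card ?N = 6"
    unfolding N by (subst card_image) auto
  moreover have "{e \<in> ?E. v \<in> e} = (\<lambda>w. {v, w}) ` ?N"
  proof
    show "{e \<in> ?E. v \<in> e} \<subseteq> (\<lambda>w. {v, w}) ` ?N"
    proof
      fix e
      assume e: "e \<in> {e \<in> ?E. v \<in> e}"
      then obtain a b where "e = {a, b}" "1 \<le> a" "a < b" "b \<le> n"
        using S by (auto elim: circulant_edgeE)
      then show "e \<in> (\<lambda>w. {v, w}) ` ?N"
        using e by (auto simp: insert_commute)
    qed
  qed auto
  moreover have "inj_on (\<lambda>w. {v, w}) ?N"
    by (auto simp: inj_on_def doubleton_eq_iff)
  ultimately show ?thesis
    by (simp add: degree_def card_image)
qed

lemma max_degree_circulant_123:
  assumes "7 \<le> n"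
  shows "max_degree (circulant n {1, 2, 3}) = 6"
proof -
  have "degree (circulant n {1, 2, 3}) ` {1..n} = {6}"
    using assms degree_circulant_123 by (force simp del: One_nat_def)
  then show ?thesis
    by (simp add: max_degree_def)
qed

text \<open>The triangle on 1, 2, 3 admits no alternation of parities.\<close>

lemma circulant_123_not_dispersable:
  assumes "7 \<le> n"
  shows "\<not> dispersable (circulant n {1, 2, 3})"
proof
  let ?G = "circulant n {1, 2, 3}"
  assume "dispersable ?G"
  then obtain \<omega> c where "matching_book_embedding ?G \<omega> c" "num_colors ?G c = 6"
    unfolding dispersable_def max_degree_circulant_123[OF assms] by blast
  then have bip: "even (\<omega> u) \<longleftrightarrow> odd (\<omega> v)" if "{u, v} \<in> edges ?G" for u v
    using degree_circulant_123[OF assms] that by (intro dispersable_regular_bipartite) simp_all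
  have "{1, 2} \<in> edges ?G" "{2, 3} \<in> edges ?G" "{1, 3} \<in> edges ?G"
    using assms by (auto simp: circulant_edge_iff)
  from this[THEN bip] show False
    by blast
qed

section \<open>Seven pages in the natural order\<close>

text \<open>In the natural order, three vertices \<open>i, i + 1, i + 2\<close> carry the edge \<open>{i, i + 2}\<close> and four vertices
  \<open>i, \<dots>, i + 3\<close> carry the nested edges \<open>{i, i + 3}\<close> and \<open>{i + 1, i + 2}\<close>. The pages \<open>0, 1, 2\<close> are the
  three partitions of the circle into blocks of the first kind, the pages \<open>3, \<dots>, 6\<close> the four
  partitions into blocks of the second kind. The starting vertex of an edge is its larger element
  if the edge passes over the point between \<open>n\<close> and \<open>1\<close>.\<close>

definition block_page :: "nat \<Rightarrow> nat \<Rightarrow> nat" where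
  "block_page d s = (if d = 2 then s mod 3 else if d = 1 then 3 + (s + 3) mod 4 else 3 + s mod 4)"

definition page :: "nat \<Rightarrow> nat set \<Rightarrow> nat" where
  "page n e =
     (if Max e - Min e \<le> 3 then block_page (Max e - Min e) (Min e)
      else block_page (n - (Max e - Min e)) (Max e))"

lemma page_doubleton:
  assumes "a < b"
  shows "page n {a, b} = (if b - a \<le> 3 then block_page (b - a) a else block_page (n - (b - a)) b)"
  using assms by (simp add: page_def max_def min_def)

text \<open>Turns a congruence into linear cases. The exact gap \<open>k\<close> is kept apart from
  larger ones because, with block starts normalised up to one period, it may mean two nested edges
  of the same block.\<close>

lemma mod_eq_gap:
  fixes x y k :: nat
  assumes "x mod k = y mod k"
  shows "x = y \<or> x + k = y \<or> y + k = x \<or> x + 2 * k \<le> y \<or> y + 2 * k \<le> x"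
proof -
  have *: "x + k = y \<or> x + 2 * k \<le> y" if xy: "x mod k = y mod k" "x < y" for x y :: nat
  proof -
    have "k dvd y - x"
      using xy by (simp add: mod_eq_dvd_iff_nat[symmetric])
    then obtain q where q: "y - x = k * q" ..
    with xy have "q \<noteq> 0"
      by (metis mult_0_right zero_less_diff less_irrefl)
    then consider "q = 1" | "q \<ge> 2"
      by linarith
    then show ?thesis
    proof cases
      case 2
      then have "k * 2 \<le> y - x"
        unfolding q by simp
      then show ?thesis
        using xy by linarith
    qed (use q xy in auto)
  qed
  from *[of x y] *[of y x] assms show ?thesis
    by linarith
qed

text \<open>The page of an edge over the gap between \<open>n\<close> and \<open>1\<close> is given by a residue near \<open>n\<close> and by the
  same residue near \<open>1\<close>, because \<open>n\<close> is a multiple of \<open>3\<close> and \<open>4\<close>.\<close>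

lemma page_residues:
  assumes n: "n = 12 * m" "m \<ge> 1"
    and e: "1 \<le> a" "a < b" "b \<le> n" "b - a \<in> {1, 2, 3} \<or> n - (b - a) \<in> {1, 2, 3}"
  obtains
    (three) x y where "page n {a, b} = x mod 3" "page n {a, b} = y mod 3"
      "b = a + 2 \<and> x = a \<and> y = a \<or> b + 2 = a + n \<and> x = b \<and> y = a + 1"
  | (four) x y where "page n {a, b} = 3 + x mod 4" "page n {a, b} = 3 + y mod 4"
      "b = a + 1 \<and> x = a + 3 \<and> y = a + 3 \<or> b = a + 3 \<and> x = a \<and> y = a \<or>
       b + 1 = a + n \<and> x = b + 3 \<and> y = a + 2 \<or> b + 3 = a + n \<and> x = b \<and> y = a + 1"
proof -
  note pd = page_doubleton[OF e(2)] block_page_def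
  consider "b = a + 1" | "b = a + 2" | "b = a + 3" | "b + 1 = a + n" | "b + 2 = a + n" | "b + 3 = a + n"
    using e by auto
  then show thesis
  proof cases
    case 1
    then have "b - a = 1" by simp
    \<comment> \<open>Modulo 4, \<open>a + 3\<close> is \<open>a - 1\<close>, the start of the block
      whose inner edge is \<open>{a, a + 1}\<close>.\<close>
    then have "page n {a, b} = 3 + (a + 3) mod 4" by (simp add: pd)
    then show thesis using 1 four by blast
  next
    case 2
    then have "b - a = 2" by simp
    then have "page n {a, b} = a mod 3" by (simp add: pd)
    then show thesis using 2 three by blast
  next
    case 3
    then have "b - a = 3" by simp
    then have "page n {a, b} = 3 + a mod 4" by (simp add: pd)
    then show thesis using 3 four by blast
  next
    case 4
    then have d: "b - a = n - 1" and r: "b + 3 = a + 2 + 4 * (3 * m)"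
      using n by auto
    have "(b + 3) mod 4 = (a + 2) mod 4"
      unfolding r by (rule mod_mult_self2)
    then show thesis
      using 4 n by (intro four[of "b + 3" "a + 2"]) (simp_all add: pd d)
  next
    case 5
    then have d: "b - a = n - 2" and r: "b = a + 1 + 3 * (4 * m - 1)"
      using n by auto
    have "b mod 3 = (a + 1) mod 3"
      unfolding r by (rule mod_mult_self2)
    then show thesis
      using 5 n by (intro three[of b "a + 1"]) (simp_all add: pd d)
  next
    case 6
    then have d: "b - a = n - 3" and r: "b = a + 1 + 4 * (3 * m - 1)"
      using n by auto
    have "b mod 4 = (a + 1) mod 4"
      unfolding r by (rule mod_mult_self2)
    then show thesis
      using 6 n by (intro four[of b "a + 1"]) (simp_all add: pd d)
  qed
qed

text \<open>The hypothesis \<open>shifted\<close> covers interleaving and shared ends. Pages from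
  triples are below 3, the others at least 3. Within one kind, equal pages make both residues agree,
  one suited to comparison near \<open>n\<close> and one near 1, and each gap allowed by
  \<open>mod_eq_gap\<close> contradicts the overlap.\<close>

lemma page_neq_if_shifted:
  assumes n: "n = 12 * m" "m \<ge> 1"
    and e: "1 \<le> a" "a < b" "b \<le> n" "b - a \<in> {1, 2, 3} \<or> n - (b - a) \<in> {1, 2, 3}"
    and f: "1 \<le> a'" "a' < b'" "b' \<le> n" "b' - a' \<in> {1, 2, 3} \<or> n - (b' - a') \<in> {1, 2, 3}"
    and shifted: "a \<le> a'" "a' \<le> b" "b \<le> b'" "a < a' \<or> b < b'"
  shows "page n {a, b} \<noteq> page n {a', b'}"
proof
  assume same: "page n {a, b} = page n {a', b'}"
  have n12: "n \<ge> 12"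
    using n by simp
  have small: "z mod 3 < 3" for z :: nat
    by simp
  show False
  proof (rule page_residues[OF n e]; rule page_residues[OF n f])
    fix x y x' y'
    assume "page n {a, b} = x mod 3" "page n {a, b} = y mod 3"
      "page n {a', b'} = x' mod 3" "page n {a', b'} = y' mod 3"
      and 1: "b = a + 2 \<and> x = a \<and> y = a \<or> b + 2 = a + n \<and> x = b \<and> y = a + 1"
        "b' = a' + 2 \<and> x' = a' \<and> y' = a' \<or> b' + 2 = a' + n \<and> x' = b' \<and> y' = a' + 1"
    then have "x mod 3 = x' mod 3" "y mod 3 = y' mod 3"
      using same by auto
    from 1 e(1) f(3) n12 shifted this[THEN mod_eq_gap] show False
      by (elim disjE conjE; linarith)
  next
    fix x y x' y'
    assume "page n {a, b} = 3 + x mod 4" "page n {a, b} = 3 + y mod 4"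
      "page n {a', b'} = 3 + x' mod 4" "page n {a', b'} = 3 + y' mod 4"
      and 1: "b = a + 1 \<and> x = a + 3 \<and> y = a + 3 \<or> b = a + 3 \<and> x = a \<and> y = a \<or>
       b + 1 = a + n \<and> x = b + 3 \<and> y = a + 2 \<or> b + 3 = a + n \<and> x = b \<and> y = a + 1"
       "b' = a' + 1 \<and> x' = a' + 3 \<and> y' = a' + 3 \<or> b' = a' + 3 \<and> x' = a' \<and> y' = a' \<or>
       b' + 1 = a' + n \<and> x' = b' + 3 \<and> y' = a' + 2 \<or> b' + 3 = a' + n \<and> x' = b' \<and> y' = a' + 1"
    then have "x mod 4 = x' mod 4" "y mod 4 = y' mod 4"
      using same by auto
    from 1 e(1) f(3) n12 shifted this[THEN mod_eq_gap] show False
      by (elim disjE conjE; linarith)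
  next
    fix x x'
    assume "page n {a, b} = x mod 3" "page n {a', b'} = 3 + x' mod 4"
    then show False
      using same small[of x] by linarith
  next
    fix x x'
    assume "page n {a, b} = 3 + x mod 4" "page n {a', b'} = x' mod 3"
    then show False
      using same small[of x'] by linarith
  qed
qed

text \<open>Two distinct intervals that are neither disjoint nor strictly nested are shifted, in one
  order or the other.\<close>

lemma page_conflict_free:
  assumes n: "n = 12 * m" "m \<ge> 1"
    and e: "1 \<le> a" "a < b" "b \<le> n" "b - a \<in> {1, 2, 3} \<or> n - (b - a) \<in> {1, 2, 3}"
    and f: "1 \<le> a'" "a' < b'" "b' \<le> n" "b' - a' \<in> {1, 2, 3} \<or> n - (b' - a') \<in> {1, 2, 3}"
    and same: "page n {a, b} = page n {a', b'}" and ne: "\<not> (a = a' \<and> b = b')"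
  shows "a < a' \<and> b' < b \<or> a' < a \<and> b < b' \<or> b < a' \<or> b' < a"
proof (rule ccontr)
  assume overlap: "\<not> ?thesis"
  show False
  proof (cases "a < a' \<or> a = a' \<and> b < b'")
    case True
    then have "a \<le> a'" "a' \<le> b" "b \<le> b'" "a < a' \<or> b < b'"
      using overlap by auto
    then show False
      using page_neq_if_shifted[OF n e f] same by blast
  next
    case False
    then have "a' \<le> a" "a \<le> b'" "b' \<le> b" "a' < a \<or> b' < b"
      using overlap ne by auto
    then show False
      using page_neq_if_shifted[OF n f e] same by simp
  qed
qed

lemma matching_book_embedding_page:
  fixes n m :: nat
  assumes "m \<ge> 1" and n: "n = 12 * m"
  shows "matching_book_embedding (circulant n {1, 2, 3}) (\<lambda>v. v - 1) (page n)"
  unfolding matching_book_embedding_def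
proof (intro conjI ballI impI)
  let ?G = "circulant n {1, 2, 3}"
  have S: "{1, 2, 3} \<subseteq> {1..<n}"
    using assms by auto
  show "simple_graph ?G"
    using S by (rule simple_graph_circulant)
  show "cyclic_order (verts ?G) (\<lambda>v. v - 1)"
    unfolding cyclic_order_def
    by (rule bij_betw_byWitness[where f' = Suc]) auto
  fix e f
  assume e: "e \<in> edges ?G" and f: "f \<in> edges ?G" and ef: "e \<noteq> f \<and> page n e = page n f"
  obtain a b where ab: "e = {a, b}" "1 \<le> a" "a < b" "b \<le> n"
      "b - a \<in> {1, 2, 3} \<or> n - (b - a) \<in> {1, 2, 3}"
    using e S by (rule circulant_edgeE)
  obtain a' b' where ab': "f = {a', b'}" "1 \<le> a'" "a' < b'" "b' \<le> n"
      "b' - a' \<in> {1, 2, 3} \<or> n - (b' - a') \<in> {1, 2, 3}"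
    using f S by (rule circulant_edgeE)
  have sep: "a < a' \<and> b' < b \<or> a' < a \<and> b < b' \<or> b < a' \<or> b' < a"
    using ef ab ab' by (intro page_conflict_free[OF n assms(1) ab(2-5) ab'(2-5)]) auto
  then show "e \<inter> f = {}"
    unfolding ab(1) ab'(1) using ab(3) ab'(3) by auto
  have lt: "a - 1 < b - 1" "b - 1 < card (verts ?G)" "a' - 1 < card (verts ?G)"
      "b' - 1 < card (verts ?G)"
    using ab ab' by auto
  show "\<not> cross (verts ?G) (\<lambda>v. v - 1) e f"
    unfolding ab(1) ab'(1)
    using sep ab(2-4) ab'(2-4)
    by (intro not_cross_if_not_interleaved lt) auto
qed

lemma num_colors_page:
  assumes "7 \<le> n"
  shows "num_colors (circulant n {1, 2, 3}) (page n) = 7"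
proof -
  let ?E = "edges (circulant n {1, 2, 3})"
  have "page n e < 7" for e
  proof -
    have "s mod 3 < 3" "s mod 4 < 4" for s :: nat
      by simp_all
    then have "block_page d s < 7" for d s
      unfolding block_page_def by (smt (verit) add_less_cancel_left less_trans numeral_plus_numeral semiring_norm)
    then show ?thesis
      by (simp add: page_def)
  qed
  moreover have "{..<7} \<subseteq> page n ` ?E"
  proof -
    \<comment> \<open>\<open>num_colors\<close> counts only colours in use, so each page needs a
      witness: the length 2 edges hit pages 1, 2, 0 and the length 3 edges hit 4, 5, 6, 3.\<close>
    have "{1, 3} \<in> ?E" "{2, 4} \<in> ?E" "{3, 5} \<in> ?E" "{1, 4} \<in> ?E" "{2, 5} \<in> ?E" "{3, 6} \<in> ?E" "{4, 7} \<in> ?E"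
      using assms by (auto simp: circulant_edge_iff)
    then have "page n ` {{1, 3}, {2, 4}, {3, 5}, {1, 4}, {2, 5}, {3, 6}, {4, 7}} \<subseteq> page n ` ?E"
      by (intro image_mono) simp
    moreover have "page n ` {{1, 3}, {2, 4}, {3, 5}, {1, 4}, {2, 5}, {3, 6}, {4, 7}} = {..<7}"
      by (auto simp: page_doubleton block_page_def)
    ultimately show ?thesis by (simp only:)
  qed
  ultimately have "page n ` ?E = {..<7}"
    by auto
  then show ?thesis
    by (simp add: num_colors_def)
qed

theorem theorem9:
  fixes n m :: nat
  assumes "m \<ge> 1" and "n = 12 * m"
  shows "nearly_dispersable (circulant n {1, 2, 3})"
proof -
  have "7 \<le> n"
    using assms by simp
  then show ?thesis
    unfolding nearly_dispersable_def
    using circulant_123_not_dispersable matching_book_embedding_page[OF assms] num_colors_page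
      max_degree_circulant_123
    by fastforce
qed

end
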